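(* Let $Z_1, Z_2, \ldots$ be i.i.d. real random variables with distribution function $F$, let $\delta \in (0,1)$, and let $Z \sim F$ be independent of $(Z_i)_{i\ge 1}$. With $C_i^{l,\alpha}$ and $\alpha_i^\ast(\alpha)$ as defined in the context (both are functions of $Z_1,\ldots,Z_i$, $\alpha$ and $\delta$), $$\mathbb{P}\Big(\forall i \in \mathbb{N},\ \forall \alpha \in (0,1):\ 1-\alpha_i^\ast(\alpha) \ \ge\ \mathbb{P}\big(Z \in C_i^{l,\alpha}\big)\ \ge\ 1-\alpha\Big) \ \ge\ 1-\delta .$$ Here the inner probability is over $Z$ only, with $Z_1,\ldots,Z_i$ (hence $C_i^{l,\alpha}$) held fixed, and the outer probability is over the sequence $(Z_i)_{i\ge1}$.
   Context: $\mathbb{N}=\{1,2,\ldots\}$. For $i \in \mathbb{N}$ the empirical distribution function is $\hat F_i(x) = \frac1i\sum_{j=1}^i \mathbb{I}_{Z_j\le x}$. The upper and lower empirical quantile functions are $$\hat Q_i(p) = \sup\{x\in\mathbb{R} : \hat F_i(x)\le p\},\qquad \hat Q_i^-(p)=\sup\{x\in\mathbb{R} : \hat F_i(x)<p\},$$ with values in $[-\infty,+\infty]$; they are evaluated by the same formulas for every real $p$, with $\sup\emptyset=-\infty$ and the supremum of a set unbounded above equal to $+\infty$. For the fixed $\delta\in(0,1)$ put $$g_i = 0.85\sqrt{\tfrac1i\big[\log(\log(e i)) + 0.8\log(1612/\delta)\big]} .$$ For $\alpha\in(0,1)$ define the interval $$C_i^{l,\alpha} = \big[\hat Q_i(\alpha/2-g_i),\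 \hat Q_i^-(1-\alpha/2+g_i)\big]$$ (understood as the set of real numbers between the two possibly infinite endpoints), and $$\alpha_i^l(\alpha) = \sup\{\tilde\alpha\in[0,1] : \hat Q_i^-(\tilde\alpha/2+g_i) < \hat Q_i(\alpha/2-g_i)\},$$ $$\alpha_i^u(\alpha) = \sup\{\tilde\alpha\in[0,1] : \hat Q_i(1-\tilde\alpha/2-g_i) > \hat Q_i(1-\alpha/2+g_i)\},$$ where each of these two suprema is taken to be $0$ if the set is empty. Finally $\alpha_i^\ast(\alpha) = \min(\alpha_i^l(\alpha),\alpha_i^u(\alpha))$. The following known theorem of Howard and Ramdas may be used: for $Z_1,Z_2,\ldots$ i.i.d. with distribution function $F$ and $Q(p)=\sup\{x: F(x)\le p\}$, one has $\mathbb{P}\big(\forall i\in\mathbb{N},\ \forall p\in(0,1):\ Q(p)\in[\hat Q_i(p-g_i),\hat Q_i^-(p+g_i)]\big)\ge 1-\delta$, where $g_i = 0.85\sqrt{\tfrac1i\big[\log(\log(e i)) + 0.8\log(1612/\delta)\big]}$. *)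

theory Defs
  imports "HOL-Probability.Probability"
begin

text \<open>Sequences are indexed by the positive natural numbers: index 0 of a
  \<^typ>\<open>nat\<close>-indexed family is never used.\<close>

definition iid_cdf :: "'a measure \<Rightarrow> (nat \<Rightarrow> 'a \<Rightarrow> real) \<Rightarrow> (real \<Rightarrow> real) \<Rightarrow> bool" where
  "iid_cdf M Z F \<longleftrightarrow>
     prob_space.indep_vars M (\<lambda>_. borel) Z {1..} \<and>
     (\<forall>j\<ge>1. cdf (distr M borel (Z j)) = F)"

text \<open>Quantile functions are defined for every real \<open>p\<close>, not only for probabilities; in
  \<^typ>\<open>ereal\<close> the supremum of the empty set is \<open>-\<infinity>\<close> and that of an unbounded
  set is \<open>\<infinity>\<close>.\<close>

definition upper_quantile :: "(real \<Rightarrow> real) \<Rightarrow> real \<Rightarrow> ereal" where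
  "upper_quantile G p = Sup (ereal ` {x. G x \<le> p})"

definition lower_quantile :: "(real \<Rightarrow> real) \<Rightarrow> real \<Rightarrow> ereal" where
  "lower_quantile G p = Sup (ereal ` {x. G x < p})"

text \<open>Below, \<open>z\<close> is a realised sample path \<open>z 1, z 2, \<dots>\<close>.\<close>

definition ecdf :: "(nat \<Rightarrow> real) \<Rightarrow> nat \<Rightarrow> real \<Rightarrow> real" where
  "ecdf z i x = (1 / real i) * (\<Sum>j=1..i. of_bool (z j \<le> x))"

abbreviation Qhat :: "(nat \<Rightarrow> real) \<Rightarrow> nat \<Rightarrow> real \<Rightarrow> ereal" where
  "Qhat z i \<equiv> upper_quantile (ecdf z i)"

abbreviation Qhat_minus :: "(nat \<Rightarrow> real) \<Rightarrow> nat \<Rightarrow> real \<Rightarrow> ereal" where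
  "Qhat_minus z i \<equiv> lower_quantile (ecdf z i)"

definition g_rad :: "real \<Rightarrow> nat \<Rightarrow> real" where
  "g_rad \<delta> i = 0.85 * sqrt ((1 / real i) * (ln (ln (exp 1 * real i)) + 0.8 * ln (1612 / \<delta>)))"

definition C_l :: "real \<Rightarrow> (nat \<Rightarrow> real) \<Rightarrow> nat \<Rightarrow> real \<Rightarrow> real set" where
  "C_l \<delta> z i \<alpha> =
     {x. Qhat z i (\<alpha> / 2 - g_rad \<delta> i) \<le> ereal x \<and> ereal x \<le> Qhat_minus z i (1 - \<alpha> / 2 + g_rad \<delta> i)}"

text \<open>The supremum of the empty set of reals is unspecified in the library, whereas here it is
  to be \<open>0\<close>.\<close>

definition sup0 :: "real set \<Rightarrow> real" where
  "sup0 S = (if S = {} then 0 else Sup S)"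

definition alpha_l :: "real \<Rightarrow> (nat \<Rightarrow> real) \<Rightarrow> nat \<Rightarrow> real \<Rightarrow> real" where
  "alpha_l \<delta> z i \<alpha> =
     sup0 {a \<in> {0..1}. Qhat_minus z i (a / 2 + g_rad \<delta> i) < Qhat z i (\<alpha> / 2 - g_rad \<delta> i)}"

definition alpha_u :: "real \<Rightarrow> (nat \<Rightarrow> real) \<Rightarrow> nat \<Rightarrow> real \<Rightarrow> real" where
  "alpha_u \<delta> z i \<alpha> =
     sup0 {a \<in> {0..1}. Qhat z i (1 - a / 2 - g_rad \<delta> i) > Qhat z i (1 - \<alpha> / 2 + g_rad \<delta> i)}"

definition alpha_star :: "real \<Rightarrow> (nat \<Rightarrow> real) \<Rightarrow> nat \<Rightarrow> real \<Rightarrow> real" where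
  "alpha_star \<delta> z i \<alpha> = min (alpha_l \<delta> z i \<alpha>) (alpha_u \<delta> z i \<alpha>)"

text \<open>The time- and quantile-uniform confidence band of Howard and Ramdas, as a closed
  proposition about all i.i.d. sequences on all probability spaces over the sample type
  \<^typ>\<open>'a\<close>. It is a published theorem that serves as a premise.\<close>

definition howard_ramdas :: "'a itself \<Rightarrow> bool" where
  "howard_ramdas (_ :: 'a itself) \<longleftrightarrow>
     (\<forall>(M :: 'a measure) (Z :: nat \<Rightarrow> 'a \<Rightarrow> real) (F :: real \<Rightarrow> real) (\<delta> :: real).
        prob_space M \<and> iid_cdf M Z F \<and> 0 < \<delta> \<and> \<delta> < 1 \<longrightarrow>
        measure M {\<omega> \<in> space M. \<forall>i\<ge>1. \<forall>p\<in>{0<..<1}.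
            upper_quantile F p \<in> {Qhat (\<lambda>j. Z j \<omega>) i (p - g_rad \<delta> i) ..
                                   Qhat_minus (\<lambda>j. Z j \<omega>) i (p + g_rad \<delta> i)}} \<ge> 1 - \<delta>)"

end

theory Submission
  imports Defs
begin

text \<open>On the Howard--Ramdas event every population quantile lies between the two empirical
  quantiles, so the claimed bounds hold there pointwise:
  \<open>Q(\<alpha>/2)\<close> and \<open>Q(1 - \<alpha>/2)\<close> lie in the interval, and each tail that the
  interval cuts off has mass at least \<open>a/2\<close> for every admissible \<open>a\<close>. Since the
  measure of a non-measurable set is \<open>0\<close>, the event of the theorem must also be shown to be
  measurable. As the empirical distribution function has finite range, the end points of the
  interval are right-continuous step functions of \<open>\<alpha>\<close>, while the adjusted level is
  monotone in \<open>\<alpha>\<close>; hence rational \<open>\<alpha>\<close> suffice.\<close>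

section \<open>Quantile functions\<close>

lemma upper_quantile_mono: "p \<le> q \<Longrightarrow> upper_quantile G p \<le> upper_quantile G q"
  unfolding upper_quantile_def by (intro Sup_subset_mono image_mono) auto

lemma lower_quantile_mono: "p \<le> q \<Longrightarrow> lower_quantile G p \<le> lower_quantile G q"
  unfolding lower_quantile_def by (intro Sup_subset_mono image_mono) auto

lemma lower_quantile_le_upper_quantile: "lower_quantile G p \<le> upper_quantile G p"
  unfolding lower_quantile_def upper_quantile_def by (intro Sup_subset_mono image_mono) auto

text \<open>The set \<open>{x. G x \<le> q}\<close> depends only on which of the finitely many
  values of \<open>G\<close> are at most \<open>q\<close>. A small step to the right of
  \<open>p\<close> passes no further value, and a value equal to \<open>p\<close> stays
  included.\<close>

lemma upper_quantile_eventually_const_right: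
  assumes "finite (range G)"
  shows "eventually (\<lambda>q. upper_quantile G q = upper_quantile G p) (at_right p)"
proof -
  have "eventually (\<lambda>q. \<forall>y\<in>range G. (y \<le> q) = (y \<le> p)) (at_right p)"
  proof (intro eventually_ball_finite[OF assms] ballI)
    fix y
    show "eventually (\<lambda>q. (y \<le> q) = (y \<le> p)) (at_right p)"
    proof (cases "y \<le> p")
      case True
      then show ?thesis
        by (auto intro: eventually_mono[OF eventually_at_right_less[of p]])
    next
      case False
      then show ?thesis
        unfolding eventually_at_right_field by (intro exI[of _ y]) auto
    qed
  qed
  then show ?thesis
    by (rule eventually_mono) (auto simp: upper_quantile_def)
qed

text \<open>With the strict inequality a value equal to \<open>p\<close> is excluded for every
  \<open>q \<le> p\<close>, so here the constancy is on the left.\<close>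

lemma lower_quantile_eventually_const_left:
  assumes "finite (range G)"
  shows "eventually (\<lambda>q. lower_quantile G q = lower_quantile G p) (at_left p)"
proof -
  have "eventually (\<lambda>q. \<forall>y\<in>range G. (y < q) = (y < p)) (at_left p)"
  proof (intro eventually_ball_finite[OF assms] ballI)
    fix y
    show "eventually (\<lambda>q. (y < q) = (y < p)) (at_left p)"
    proof (cases "y < p")
      case True
      then show ?thesis
        unfolding eventually_at_left_field by (intro exI[of _ y]) auto
    next
      case False
      then show ?thesis
        unfolding eventually_at_left_field by (intro exI[of _ "p - 1"]) auto
    qed
  qed
  then show ?thesis
    by (rule eventually_mono) (auto simp: lower_quantile_def)
qed

text \<open>Makes a quantile a countable supremum, as measurability requires. Rationals outside
  \<open>S\<close> contribute the neutral element \<open>-\<infinity>\<close>.\<close>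

lemma Sup_ereal_down_closed:
  fixes S :: "real set"
  assumes down: "\<And>x y. y \<in> S \<Longrightarrow> x \<le> y \<Longrightarrow> x \<in> S"
  shows "Sup (ereal ` S) = (SUP q::rat. if of_rat q \<in> S then ereal (of_rat q) else -\<infinity>)"
proof (rule antisym)
  show "Sup (ereal ` S) \<le> (SUP q::rat. if of_rat q \<in> S then ereal (of_rat q) else -\<infinity>)" (is "_ \<le> ?R")
  proof (rule SUP_least)
    fix y assume y: "y \<in> S"
    show "ereal y \<le> ?R"
    proof (rule dense_le)
      fix c assume c: "c < ereal y"
      show "c \<le> ?R"
      proof (cases c)
        case (real r)
        then have "r < y" using c by simp
        then obtain q where q: "r < of_rat q" "of_rat q < y"
          using of_rat_dense by blast
        then have "of_rat q \<in> S" using down[OF y] by simp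
        then have "c \<le> (if of_rat q \<in> S then ereal (of_rat q) else -\<infinity>)"
          using q real by simp
        also have "\<dots> \<le> ?R" by (rule SUP_upper) simp
        finally show ?thesis .
      qed (use c in auto)
    qed
  qed
  show "(SUP q::rat. if of_rat q \<in> S then ereal (of_rat q) else -\<infinity>) \<le> Sup (ereal ` S)"
    by (rule SUP_least) (auto intro: SUP_upper)
qed

lemma ecdf_mono: "x \<le> y \<Longrightarrow> ecdf z i x \<le> ecdf z i y"
  unfolding ecdf_def by (intro mult_left_mono sum_mono) auto

text \<open>Only the multiples \<open>k / i\<close> with \<open>k \<le> i\<close> occur; this is
  what makes the empirical quantiles step functions.\<close>

lemma finite_range_ecdf: "finite (range (ecdf z i))"
proof (rule finite_subset)
  have "(\<Sum>j=1..i. of_bool (z j \<le> x)) = real (card {j\<in>{1..i}. z j \<le> x})" for x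
    by (simp add: of_bool_def sum.If_cases Int_def)
  moreover have "card {j\<in>{1..i}. z j \<le> x} \<le> i" for x
    using card_mono[of "{1..i}" "{j\<in>{1..i}. z j \<le> x}"] by fastforce
  ultimately show "range (ecdf z i) \<subseteq> (\<lambda>k. (1 / real i) * real k) ` {..i}"
    unfolding ecdf_def by auto
qed simp

text \<open>Reduces a strict lower bound on the supremum to countably many membership tests, for
  measurability in the sample path. The disjunct \<open>c < 0\<close> is there because
  \<open>sup0 S\<close> is never negative, even for empty \<open>S\<close>.\<close>

lemma sup0_less_iff:
  assumes S: "S \<subseteq> {0..1::real}" and down: "\<And>x y. y \<in> S \<Longrightarrow> 0 \<le> x \<Longrightarrow> x \<le> y \<Longrightarrow> x \<in> S"
  shows "c < sup0 S \<longleftrightarrow> c < 0 \<or> (\<exists>q::rat. c < of_rat q \<and> of_rat q \<in> S)"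
proof -
  have bdd: "bdd_above S" using S by (rule bdd_above_mono[rotated]) simp
  have upper: "x \<le> sup0 S" if "x \<in> S" for x
    using that cSup_upper[OF that bdd] by (auto simp: sup0_def)
  have nonneg: "0 \<le> sup0 S"
  proof (cases "S = {}")
    case False
    then obtain x where "x \<in> S" by blast
    then show ?thesis using upper[of x] S by force
  qed (simp add: sup0_def)
  show ?thesis
  proof (cases "c < 0")
    case True
    then show ?thesis using nonneg by simp
  next
    case False
    have "\<exists>q::rat. c < of_rat q \<and> of_rat q \<in> S" if c: "c < sup0 S"
    proof -
      have ne: "S \<noteq> {}" using c False by (auto simp: sup0_def)
      then obtain y where y: "y \<in> S" "c < y"
        using c less_cSup_iff[OF ne bdd] by (auto simp: sup0_def)
      obtain q :: rat where q: "c < of_rat q" "of_rat q < y" using of_rat_dense y(2) by blast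
      \<comment> \<open>Since \<open>c\<close> is not negative, neither is \<open>q\<close>, so
        \<open>q\<close> is in the range where \<open>S\<close> is down-closed.\<close>
      then have "of_rat q \<in> S" using down[OF y(1), of "of_rat q"] False by linarith
      with q(1) show ?thesis by blast
    qed
    then show ?thesis using False upper by force
  qed
qed

lemma sup0_mono:
  assumes "S \<subseteq> T" "T \<subseteq> {0..1::real}"
  shows "sup0 S \<le> sup0 T"
proof -
  have bdd: "bdd_above T" using assms(2) by (rule bdd_above_mono[rotated]) simp
  \<comment> \<open>For empty \<open>S\<close> and nonempty \<open>T\<close> the default value
    \<open>0\<close> has to be compared with a genuine supremum.\<close>
  have "0 \<le> Sup T" if ne: "T \<noteq> {}"
  proof -
    obtain x where "x \<in> T" using ne by blast
    then show ?thesis using cSup_upper[OF _ bdd, of x] assms(2) by force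
  qed
  then show ?thesis
    using assms cSup_subset_mono[OF _ bdd assms(1)] by (auto simp: sup0_def)
qed

lemma sup0_le:
  assumes "0 \<le> b" "\<And>a. a \<in> S \<Longrightarrow> a \<le> b"
  shows "sup0 S \<le> b"
  using assms by (auto simp: sup0_def intro: cSup_least)

lemma alpha_star_mono:
  assumes "\<alpha> \<le> \<beta>"
  shows "alpha_star \<delta> z i \<alpha> \<le> alpha_star \<delta> z i \<beta>"
proof -
  \<comment> \<open>A larger level moves both thresholds inward, so more candidates pass the strict
    comparisons.\<close>
  have "Qhat z i (\<alpha> / 2 - g_rad \<delta> i) \<le> Qhat z i (\<beta> / 2 - g_rad \<delta> i)"
    and "Qhat z i (1 - \<beta> / 2 + g_rad \<delta> i) \<le> Qhat z i (1 - \<alpha> / 2 + g_rad \<delta> i)"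
    using assms by (auto intro!: upper_quantile_mono)
  then have "alpha_l \<delta> z i \<alpha> \<le> alpha_l \<delta> z i \<beta>" "alpha_u \<delta> z i \<alpha> \<le> alpha_u \<delta> z i \<beta>"
    unfolding alpha_l_def alpha_u_def by (auto intro!: sup0_mono)
  then show ?thesis unfolding alpha_star_def by linarith
qed

text \<open>As \<beta> decreases to \<alpha>, the argument of the upper quantile approaches its
  limit from the right and that of the lower quantile from the left: for each the side on which it
  is locally constant.\<close>

lemma C_l_eventually_const_right:
  "eventually (\<lambda>\<beta>. C_l \<delta> z i \<beta> = C_l \<delta> z i \<alpha>) (at_right \<alpha>)"
proof -
  have "filterlim (\<lambda>\<beta>. \<beta> / 2 - g_rad \<delta> i) (at_right (\<alpha> / 2 - g_rad \<delta> i)) (at_right \<alpha>)"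
    unfolding filterlim_at
    by (auto intro!: tendsto_eq_intros eventually_mono[OF eventually_at_right_less[of \<alpha>]])
  then have *: "eventually (\<lambda>\<beta>. Qhat z i (\<beta> / 2 - g_rad \<delta> i) = Qhat z i (\<alpha> / 2 - g_rad \<delta> i)) (at_right \<alpha>)"
    using upper_quantile_eventually_const_right[OF finite_range_ecdf]
    by (rule eventually_compose_filterlim[rotated])
  have "filterlim (\<lambda>\<beta>. 1 - \<beta> / 2 + g_rad \<delta> i) (at_left (1 - \<alpha> / 2 + g_rad \<delta> i)) (at_right \<alpha>)"
    unfolding filterlim_at
    by (auto intro!: tendsto_eq_intros eventually_mono[OF eventually_at_right_less[of \<alpha>]])
  then have "eventually (\<lambda>\<beta>. Qhat_minus z i (1 - \<beta> / 2 + g_rad \<delta> i) = Qhat_minus z i (1 - \<alpha> / 2 + g_rad \<delta> i)) (at_right \<alpha>)"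
    using lower_quantile_eventually_const_left[OF finite_range_ecdf]
    by (rule eventually_compose_filterlim[rotated])
  with * show ?thesis by eventually_elim (simp add: C_l_def)
qed

section \<open>Coverage on the confidence band\<close>

context real_distribution
begin

text \<open>The distribution function is at most \<open>p\<close> to the left of the quantile and
  exceeds \<open>p\<close> to its right. Its left limit at \<open>r\<close> is
  \<open>prob {..<r}\<close>, and right continuity handles \<open>prob {..r}\<close>; a possible
  atom at \<open>r\<close> is why two half-lines appear.\<close>

lemma upper_quantile_cdf:
  assumes p: "0 < p" "p < 1"
  obtains r where "upper_quantile (cdf M) p = ereal r" "prob {..<r} \<le> p" "p \<le> prob {..r}"
proof -
  let ?Q = "upper_quantile (cdf M) p"
  have below: "cdf M x \<le> p" if x: "ereal x < ?Q" for x
  proof -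
    obtain y where "cdf M y \<le> p" "x < y"
      using x unfolding upper_quantile_def less_SUP_iff by auto
    then show ?thesis using cdf_nondecreasing[of x y] by linarith
  qed
  have above: "p < cdf M x" if "?Q < ereal x" for x
  proof (rule ccontr)
    assume "\<not> p < cdf M x"
    then have "ereal x \<le> ?Q" unfolding upper_quantile_def by (intro SUP_upper) auto
    then show False using that by simp
  qed
  \<comment> \<open>The limits 0 and 1 lie strictly on either side of \<open>p\<close>; the
    resulting points \<open>a\<close> and \<open>b\<close> bracket the quantile, which is therefore
    finite.\<close>
  have "eventually (\<lambda>x. cdf M x < p) at_bot" "eventually (\<lambda>x. p < cdf M x) at_top"
    using order_tendstoD(2)[OF cdf_lim_at_bot p(1)] order_tendstoD(1)[OF cdf_lim_at_top_prob p(2)]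
    by auto
  then obtain a b where a: "cdf M a < p" and b: "p < cdf M b"
    by (meson eventually_happens trivial_limit_at_bot_linorder trivial_limit_at_top_linorder)
  have "ereal a \<le> ?Q" using above[of a] a by force
  moreover have "?Q \<le> ereal b" using below[of b] b by force
  ultimately obtain r where r: "?Q = ereal r" by (cases ?Q) auto
  have "prob {..<r} \<le> p"
    by (rule tendsto_upperbound[OF cdf_at_left])
      (auto intro!: eventually_mono[OF eventually_at_left_real[of "r - 1" r]] below simp: r)
  moreover have "p \<le> prob {..r}"
  proof -
    have "(cdf M \<longlongrightarrow> cdf M r) (at_right r)"
      using cdf_is_right_cont[of r] by (simp add: continuous_within)
    then have "p \<le> cdf M r"
      by (rule tendsto_lowerbound)
        (auto intro!: eventually_mono[OF eventually_at_right_less[of r]] less_imp_le above simp: r)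
    then show ?thesis by (simp add: cdf_def)
  qed
  ultimately show ?thesis using that r by blast
qed

text \<open>With \<open>r\<close> and \<open>s\<close> the two quantiles, the set contains every
  \<open>x\<close> with \<open>r \<le> x \<le> s\<close>. Together with \<open>{..<r}\<close>, of
  mass at most \<open>p\<close>, it covers \<open>{..s}\<close>, of mass at least
  \<open>q\<close>.\<close>

lemma prob_ge_if_quantiles_between:
  assumes p: "0 < p" "p < 1" and q: "0 < q" "q < 1"
    and L: "L \<le> upper_quantile (cdf M) p" and U: "upper_quantile (cdf M) q \<le> U"
  shows "q - p \<le> prob {x. L \<le> ereal x \<and> ereal x \<le> U}"
proof -
  obtain r where r: "upper_quantile (cdf M) p = ereal r" "prob {..<r} \<le> p"
    using upper_quantile_cdf[OF p] by metis
  obtain s where s: "upper_quantile (cdf M) q = ereal s" "q \<le> prob {..s}"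
    using upper_quantile_cdf[OF q] by metis
  let ?C = "{x. L \<le> ereal x \<and> ereal x \<le> U}"
  have C: "?C \<in> sets M" by simp
  have "{..s} \<subseteq> {..<r} \<union> ?C"
  proof
    fix x assume x: "x \<in> {..s}"
    have "L \<le> ereal x" if "r \<le> x" using that L r(1) by (metis ereal_less_eq(3) order_trans)
    moreover have "ereal x \<le> U" using x U s(1) by (metis atMost_iff ereal_less_eq(3) order_trans)
    ultimately show "x \<in> {..<r} \<union> ?C" by force
  qed
  then have "prob {..s} \<le> prob ({..<r} \<union> ?C)"
    using C by (intro finite_measure_mono) auto
  also have "\<dots> \<le> prob {..<r} + prob ?C"
    using C by (intro measure_Un_le) auto
  finally show ?thesis using r s by linarith
qed

text \<open>As \<open>L\<close> is strictly above the quantile, the tail below \<open>L\<close>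
  contains the closed half-line up to the quantile, including a possible atom there.\<close>

lemma prob_below_ge:
  assumes p: "0 < p" "p < 1" and L: "upper_quantile (cdf M) p < L"
  shows "p \<le> prob {x. ereal x < L}"
proof -
  obtain r where r: "upper_quantile (cdf M) p = ereal r" "p \<le> prob {..r}"
    using upper_quantile_cdf[OF p] by metis
  have "prob {..r} \<le> prob {x. ereal x < L}"
    using L r(1) by (intro finite_measure_mono) (auto intro: order.strict_trans1[of _ "ereal r"])
  then show ?thesis using r by linarith
qed

text \<open>The tail contains \<open>{r..}\<close>, whose complement \<open>{..<r}\<close> has mass
  at most \<open>p\<close>.\<close>

lemma prob_above_ge:
  assumes p: "0 < p" "p < 1" and U: "U < upper_quantile (cdf M) p"
  shows "1 - p \<le> prob {x. U < ereal x}"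
proof -
  obtain r where r: "upper_quantile (cdf M) p = ereal r" "prob {..<r} \<le> p"
    using upper_quantile_cdf[OF p] by metis
  have "1 - prob {..<r} = prob {r..}"
    using prob_compl[of "{..<r}"] by (simp add: Compl_eq_Diff_UNIV[symmetric] not_less Compl_lessThan)
  also have "\<dots> \<le> prob {x. U < ereal x}"
    using U r(1) by (intro finite_measure_mono) (auto intro: order.strict_trans2[of _ "ereal r"])
  finally show ?thesis using r by linarith
qed

text \<open>For the upper bound, the interval and its two tails are disjoint, and the tails together
  have mass at least half of \<open>alpha_l\<close> plus half of \<open>alpha_u\<close>, hence at
  least the minimum of the two.\<close>

lemma coverage_bounds:
  assumes band: "\<And>p. p \<in> {0<..<1} \<Longrightarrow>
      upper_quantile (cdf M) p \<in> {Qhat z i (p - g_rad \<delta> i) .. Qhat_minus z i (p + g_rad \<delta> i)}"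
    and \<alpha>: "0 < \<alpha>" "\<alpha> < 1"
  shows "prob (C_l \<delta> z i \<alpha>) \<le> 1 - alpha_star \<delta> z i \<alpha>" and "1 - \<alpha> \<le> prob (C_l \<delta> z i \<alpha>)"
proof -
  let ?g = "g_rad \<delta> i" and ?Q = "upper_quantile (cdf M)"
  let ?L = "Qhat z i (\<alpha> / 2 - ?g)" and ?U = "Qhat_minus z i (1 - \<alpha> / 2 + ?g)"
  have L: "?L \<le> ?Q (\<alpha> / 2)" using band[of "\<alpha> / 2"] \<alpha> by simp
  have U: "?Q (1 - \<alpha> / 2) \<le> ?U" using band[of "1 - \<alpha> / 2"] \<alpha> by simp
  show "1 - \<alpha> \<le> prob (C_l \<delta> z i \<alpha>)"
    using prob_ge_if_quantiles_between[OF _ _ _ _ L U] \<alpha> unfolding C_l_def by simp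
  let ?A = "{x. ereal x < ?L}" and ?B = "{x. ?U < ereal x}"
  have "alpha_l \<delta> z i \<alpha> \<le> 2 * prob ?A"
    unfolding alpha_l_def
  proof (rule sup0_le)
    fix a assume a: "a \<in> {a \<in> {0..1}. Qhat_minus z i (a / 2 + ?g) < ?L}"
    show "a \<le> 2 * prob ?A"
    \<comment> \<open>The level \<open>a = 0\<close> is admissible, but \<open>a / 2\<close> then
      lies outside the open range of the band; the bound is trivial there. The other tail is treated
      alike.\<close>
    proof (cases "a = 0")
      case False
      then have "?Q (a / 2) \<le> Qhat_minus z i (a / 2 + ?g)" using band[of "a / 2"] a by auto
      also have "\<dots> < ?L" using a by simp
      finally show ?thesis using prob_below_ge[of "a / 2" ?L] a False by simp
    qed simp
  qed simp
  moreover have "alpha_u \<delta> z i \<alpha> \<le> 2 * prob ?B"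
    unfolding alpha_u_def
  proof (rule sup0_le)
    fix a assume a: "a \<in> {a \<in> {0..1}. Qhat z i (1 - \<alpha> / 2 + ?g) < Qhat z i (1 - a / 2 - ?g)}"
    show "a \<le> 2 * prob ?B"
    proof (cases "a = 0")
      case False
      \<comment> \<open>The interval ends at a lower quantile, whereas \<open>alpha_u\<close>
        compares with the upper quantile at the same argument.\<close>
      have "?U \<le> Qhat z i (1 - \<alpha> / 2 + ?g)" by (rule lower_quantile_le_upper_quantile)
      also have "\<dots> < Qhat z i (1 - a / 2 - ?g)" using a by simp
      also have "\<dots> \<le> ?Q (1 - a / 2)" using band[of "1 - a / 2"] a False by auto
      finally show ?thesis using prob_above_ge[of "1 - a / 2" ?U] a False by simp
    qed simp
  qed simp
  moreover have "prob ?A + prob ?B + prob (C_l \<delta> z i \<alpha>) \<le> 1"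
  proof -
    \<comment> \<open>The population quantiles between them put the end points in order, which makes
      the two tails disjoint.\<close>
    have "?Q (\<alpha> / 2) \<le> ?Q (1 - \<alpha> / 2)" using \<alpha> by (intro upper_quantile_mono) simp
    then have LU: "?L \<le> ?U" using L U by order
    have C: "C_l \<delta> z i \<alpha> \<in> sets M" unfolding C_l_def by simp
    have A: "?A \<in> sets M" and B: "?B \<in> sets M" by simp_all
    have "?A \<inter> ?B = {}" using LU by auto
    moreover have "(?A \<union> ?B) \<inter> C_l \<delta> z i \<alpha> = {}" unfolding C_l_def by auto
    ultimately have "prob ?A + prob ?B + prob (C_l \<delta> z i \<alpha>) = prob (?A \<union> ?B \<union> C_l \<delta> z i \<alpha>)"
      using A B C by (simp add: finite_measure_Union)
    then show ?thesis by simp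
  qed
  ultimately show "prob (C_l \<delta> z i \<alpha>) \<le> 1 - alpha_star \<delta> z i \<alpha>"
    unfolding alpha_star_def by linarith
qed

end

section \<open>Measurability\<close>

lemma borel_measurable_ecdf:
  assumes "\<And>j. 1 \<le> j \<Longrightarrow> Z j \<in> borel_measurable M"
  shows "(\<lambda>\<omega>. ecdf (\<lambda>j. Z j \<omega>) i x) \<in> borel_measurable M"
proof -
  have "(\<lambda>\<omega>. of_bool (Z j \<omega> \<le> x) :: real) \<in> borel_measurable M" if "1 \<le> j" for j
    using assms[OF that] unfolding of_bool_def by measurable
  then show ?thesis
    unfolding ecdf_def by (intro borel_measurable_times borel_measurable_const borel_measurable_sum) auto
qed

lemma borel_measurable_Qhat:
  assumes "\<And>j. 1 \<le> j \<Longrightarrow> Z j \<in> borel_measurable M"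
  shows "(\<lambda>\<omega>. Qhat (\<lambda>j. Z j \<omega>) i p) \<in> borel_measurable M"
proof -
  note [measurable] = borel_measurable_ecdf[OF assms]
  \<comment> \<open>Sublevel sets of the nondecreasing \<open>ecdf\<close> are down-closed, so
    rational points determine the supremum.\<close>
  have "Qhat z i p = (SUP q::rat. if ecdf z i (of_rat q) \<le> p then ereal (of_rat q) else -\<infinity>)" for z
    unfolding upper_quantile_def
    by (subst Sup_ereal_down_closed) (auto dest: ecdf_mono[of _ _ z i])
  then show ?thesis by (simp only:) measurable
qed

lemma borel_measurable_Qhat_minus:
  assumes "\<And>j. 1 \<le> j \<Longrightarrow> Z j \<in> borel_measurable M"
  shows "(\<lambda>\<omega>. Qhat_minus (\<lambda>j. Z j \<omega>) i p) \<in> borel_measurable M"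
proof -
  note [measurable] = borel_measurable_ecdf[OF assms]
  have "Qhat_minus z i p = (SUP q::rat. if ecdf z i (of_rat q) < p then ereal (of_rat q) else -\<infinity>)" for z
    unfolding lower_quantile_def
    by (subst Sup_ereal_down_closed) (auto dest: ecdf_mono[of _ _ z i])
  then show ?thesis by (simp only:) measurable
qed

lemma borel_measurable_alpha_l:
  assumes "\<And>j. 1 \<le> j \<Longrightarrow> Z j \<in> borel_measurable M"
  shows "(\<lambda>\<omega>. alpha_l \<delta> (\<lambda>j. Z j \<omega>) i \<alpha>) \<in> borel_measurable M"
proof -
  note [measurable] = borel_measurable_Qhat[OF assms] borel_measurable_Qhat_minus[OF assms]
  \<comment> \<open>Lowering \<open>a\<close> lowers \<open>Qhat_minus\<close>, so the admissible
    levels are down-closed in the unit interval.\<close>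
  have "c < alpha_l \<delta> z i \<alpha> \<longleftrightarrow> c < 0 \<or> (\<exists>q::rat. c < of_rat q \<and> of_rat q \<in> {0..1::real} \<and>
      Qhat_minus z i (of_rat q / 2 + g_rad \<delta> i) < Qhat z i (\<alpha> / 2 - g_rad \<delta> i))" for c z
    unfolding alpha_l_def
    by (subst sup0_less_iff)
      (auto intro: order.strict_trans1[OF lower_quantile_mono[OF add_right_mono[OF divide_right_mono]]])
  then show ?thesis unfolding borel_measurable_iff_greater by simp
qed

lemma borel_measurable_alpha_u:
  assumes "\<And>j. 1 \<le> j \<Longrightarrow> Z j \<in> borel_measurable M"
  shows "(\<lambda>\<omega>. alpha_u \<delta> (\<lambda>j. Z j \<omega>) i \<alpha>) \<in> borel_measurable M"
proof -
  note [measurable] = borel_measurable_Qhat[OF assms]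
  \<comment> \<open>Here \<open>a\<close> enters with a minus sign on the larger side, so lowering
    it again preserves admissibility.\<close>
  have "c < alpha_u \<delta> z i \<alpha> \<longleftrightarrow> c < 0 \<or> (\<exists>q::rat. c < of_rat q \<and> of_rat q \<in> {0..1::real} \<and>
      Qhat z i (1 - \<alpha> / 2 + g_rad \<delta> i) < Qhat z i (1 - of_rat q / 2 - g_rad \<delta> i))" for c z
    unfolding alpha_u_def
    by (subst sup0_less_iff)
      (auto elim!: order.strict_trans2 intro!: upper_quantile_mono)
  then show ?thesis unfolding borel_measurable_iff_greater by simp
qed

lemma borel_measurable_alpha_star:
  assumes "\<And>j. 1 \<le> j \<Longrightarrow> Z j \<in> borel_measurable M"
  shows "(\<lambda>\<omega>. alpha_star \<delta> (\<lambda>j. Z j \<omega>) i \<alpha>) \<in> borel_measurable M"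
  using borel_measurable_alpha_l[OF assms] borel_measurable_alpha_u[OF assms]
  unfolding alpha_star_def by simp

text \<open>The pairs of a sample point and a real in its interval form a measurable set of the
  product space; the measure of the sections of such a set is measurable.\<close>

lemma borel_measurable_prob_C_l:
  assumes Z: "\<And>j. 1 \<le> j \<Longrightarrow> Z j \<in> borel_measurable M" and "prob_space N" and "sets N = sets borel"
  shows "(\<lambda>\<omega>. measure N (C_l \<delta> (\<lambda>j. Z j \<omega>) i \<alpha>)) \<in> borel_measurable M"
proof -
  note [measurable] = borel_measurable_Qhat[OF Z] borel_measurable_Qhat_minus[OF Z]
  note [measurable_cong] = \<open>sets N = sets borel\<close>
  interpret N: prob_space N by fact
  let ?S = "{w \<in> space (M \<Otimes>\<^sub>M N). snd w \<in> C_l \<delta> (\<lambda>j. Z j (fst w)) i \<alpha>}"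
  have "?S \<in> sets (M \<Otimes>\<^sub>M N)"
    unfolding C_l_def by simp
  then have "(\<lambda>\<omega>. measure N (Pair \<omega> -` ?S)) \<in> borel_measurable M"
    unfolding measure_def by (intro borel_measurable_enn2real N.measurable_emeasure_Pair)
  moreover have "Pair \<omega> -` ?S = C_l \<delta> (\<lambda>j. Z j \<omega>) i \<alpha>" if "\<omega> \<in> space M" for \<omega>
    using that sets_eq_imp_space_eq[OF \<open>sets N = sets borel\<close>] by (auto simp: space_pair_measure)
  ultimately show ?thesis by (simp cong: measurable_cong)
qed

text \<open>Approach \<alpha> by rationals \<open>q\<close> from above: the interval is eventually
  that of \<alpha>, \<open>alpha_star\<close> at \<open>q\<close> is at least its value at \<alpha>,
  and \<open>1 - q\<close> tends to \<open>1 - \<alpha>\<close>.\<close>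

lemma coverage_all_levels_iff_rat:
  "(\<forall>\<alpha>\<in>{0<..<1}. measure N (C_l \<delta> z i \<alpha>) \<le> 1 - alpha_star \<delta> z i \<alpha> \<and> 1 - \<alpha> \<le> measure N (C_l \<delta> z i \<alpha>))
   \<longleftrightarrow> (\<forall>q::rat. of_rat q \<in> {0<..<1::real} \<longrightarrow>
         measure N (C_l \<delta> z i (of_rat q)) \<le> 1 - alpha_star \<delta> z i (of_rat q) \<and>
         1 - of_rat q \<le> measure N (C_l \<delta> z i (of_rat q)))"
  (is "?L \<longleftrightarrow> ?R")
proof
  assume R: ?R
  show ?L
  proof
    fix \<alpha> :: real assume \<alpha>: "\<alpha> \<in> {0<..<1}"
    obtain b where b: "\<alpha> < b" "\<And>\<beta>. \<alpha> < \<beta> \<Longrightarrow> \<beta> < b \<Longrightarrow> C_l \<delta> z i \<beta> = C_l \<delta> z i \<alpha>"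
      using C_l_eventually_const_right[of \<delta> z i \<alpha>] unfolding eventually_at_right_field by blast
    have near: "\<exists>q::rat. \<alpha> < of_rat q \<and> of_rat q < c \<and>
        measure N (C_l \<delta> z i \<alpha>) \<le> 1 - alpha_star \<delta> z i (of_rat q) \<and>
        1 - of_rat q \<le> measure N (C_l \<delta> z i \<alpha>)" if c: "\<alpha> < c" for c
    proof -
      \<comment> \<open>The bound \<open>c\<close> controls the distance to \<alpha>,
        \<open>b\<close> keeps the interval unchanged, and 1 keeps \<open>q\<close> a valid
        level.\<close>
      obtain q :: rat where q: "\<alpha> < of_rat q" "of_rat q < min c (min b 1)"
        using of_rat_dense[of \<alpha> "min c (min b 1)"] c b(1) \<alpha>
        by (metis greaterThanLessThan_iff min_less_iff_conj)
      moreover have "of_rat q \<in> {0<..<1::real}"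
        using q \<alpha> unfolding greaterThanLessThan_iff by linarith
      ultimately show ?thesis using R b(2)[of "of_rat q"] by (intro exI[of _ q]) auto
    qed
    obtain q :: rat where "\<alpha> < of_rat q" "measure N (C_l \<delta> z i \<alpha>) \<le> 1 - alpha_star \<delta> z i (of_rat q)"
      using near[of 1] \<alpha> by auto
    then have "measure N (C_l \<delta> z i \<alpha>) \<le> 1 - alpha_star \<delta> z i \<alpha>"
      using alpha_star_mono[of \<alpha> "of_rat q" \<delta> z i] by linarith
    moreover have "1 - measure N (C_l \<delta> z i \<alpha>) \<le> \<alpha>"
    proof (rule dense_ge)
      fix c assume "\<alpha> < c"
      then show "1 - measure N (C_l \<delta> z i \<alpha>) \<le> c" using near[of c] by force
    qed
    ultimately show "measure N (C_l \<delta> z i \<alpha>) \<le> 1 - alpha_star \<delta> z i \<alpha> \<and> 1 - \<alpha> \<le> measure N (C_l \<delta> z i \<alpha>)"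
      by simp
  qed
qed auto

theorem theorem2:
  fixes M :: "'a measure"
    and Z :: "nat \<Rightarrow> 'a \<Rightarrow> real"
    and Znew :: "'a \<Rightarrow> real"
    and F :: "real \<Rightarrow> real"
    and \<delta> :: real
  assumes "howard_ramdas TYPE('a)"
    and "prob_space M"
    and "iid_cdf M Z F"
    and "Znew \<in> borel_measurable M"
    and "cdf (distr M borel Znew) = F"
    and "prob_space.indep_set M
           (sets (vimage_algebra (space M) Znew borel))
           (sets (vimage_algebra (space M) (\<lambda>\<omega>. \<lambda>j\<in>{1..}. Z j \<omega>) (PiM {1..} (\<lambda>_. borel))))"
    and "0 < \<delta>" and "\<delta> < 1"
  shows "measure M {\<omega> \<in> space M. \<forall>i\<ge>1. \<forall>\<alpha>\<in>{0<..<1}.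
           1 - alpha_star \<delta> (\<lambda>j. Z j \<omega>) i \<alpha>
             \<ge> measure M {\<omega>' \<in> space M. Znew \<omega>' \<in> C_l \<delta> (\<lambda>j. Z j \<omega>) i \<alpha>} \<and>
           measure M {\<omega>' \<in> space M. Znew \<omega>' \<in> C_l \<delta> (\<lambda>j. Z j \<omega>) i \<alpha>} \<ge> 1 - \<alpha>}
         \<ge> 1 - \<delta>"
proof -
  interpret prob_space M by fact
  \<comment> \<open>For a fixed path the inner probability is the measure of the interval under the
    law of \<open>Znew\<close>, whose distribution function is \<open>F\<close>; so the band for
    \<open>F\<close> is one for \<open>N\<close>.\<close>
  define N where "N = distr M borel Znew"
  interpret N: real_distribution N
    unfolding N_def using assms(4) by simp
  have F: "F = cdf N" using assms(5) by (simp add: N_def)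
  have Z: "Z j \<in> borel_measurable M" if "1 \<le> j" for j
    using assms(3) that unfolding iid_cdf_def indep_vars_def by auto
  have inner: "measure M {\<omega>' \<in> space M. Znew \<omega>' \<in> C_l \<delta> z i \<alpha>} = measure N (C_l \<delta> z i \<alpha>)" for z i \<alpha>
  proof -
    have "C_l \<delta> z i \<alpha> \<in> sets borel" unfolding C_l_def by simp
    then show ?thesis
      using assms(4) by (simp add: N_def measure_distr vimage_def Int_def conj_commute)
  qed
  let ?E = "{\<omega> \<in> space M. \<forall>i\<ge>1. \<forall>p\<in>{0<..<1}.
      upper_quantile F p \<in> {Qhat (\<lambda>j. Z j \<omega>) i (p - g_rad \<delta> i) .. Qhat_minus (\<lambda>j. Z j \<omega>) i (p + g_rad \<delta> i)}}"
  let ?T = "{\<omega> \<in> space M. \<forall>i\<ge>1. \<forall>\<alpha>\<in>{0<..<1}.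
      measure N (C_l \<delta> (\<lambda>j. Z j \<omega>) i \<alpha>) \<le> 1 - alpha_star \<delta> (\<lambda>j. Z j \<omega>) i \<alpha> \<and>
      1 - \<alpha> \<le> measure N (C_l \<delta> (\<lambda>j. Z j \<omega>) i \<alpha>)}"
  note [measurable] = borel_measurable_alpha_star[OF Z]
    borel_measurable_prob_C_l[OF Z N.prob_space_axioms N.events_eq_borel]
  \<comment> \<open>After the reduction to rational levels both quantifiers range over countable
    sets.\<close>
  have T: "?T \<in> sets M"
    unfolding coverage_all_levels_iff_rat by measurable
  have "1 - \<delta> \<le> measure M ?E"
    using assms(1-3,7,8) unfolding howard_ramdas_def by blast
  also have "\<dots> \<le> measure M ?T"
  proof (rule finite_measure_mono[OF _ T], safe)
    fix \<omega> i \<alpha>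
    assume band: "\<forall>i\<ge>1. \<forall>p\<in>{0<..<1}. upper_quantile F p \<in>
        {Qhat (\<lambda>j. Z j \<omega>) i (p - g_rad \<delta> i) .. Qhat_minus (\<lambda>j. Z j \<omega>) i (p + g_rad \<delta> i)}"
      and i: "(1::nat) \<le> i" and \<alpha>: "\<alpha> \<in> {0<..<1::real}"
    have *: "upper_quantile (cdf N) p \<in>
        {Qhat (\<lambda>j. Z j \<omega>) i (p - g_rad \<delta> i) .. Qhat_minus (\<lambda>j. Z j \<omega>) i (p + g_rad \<delta> i)}"
      if "p \<in> {0<..<1}" for p
      using band i that unfolding F by blast
    show "measure N (C_l \<delta> (\<lambda>j. Z j \<omega>) i \<alpha>) \<le> 1 - alpha_star \<delta> (\<lambda>j. Z j \<omega>) i \<alpha>"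
      and "1 - \<alpha> \<le> measure N (C_l \<delta> (\<lambda>j. Z j \<omega>) i \<alpha>)"
      using N.coverage_bounds[OF *] \<alpha> by auto
  qed
  finally show ?thesis unfolding inner .
qed

end
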